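(* Let $e(X)$, $e^*(X)$, $\mu_1(X)$, $\mu^*_1(X)$ be, respectively, the true propensity score, the limiting misspecified propensity score, the true conditional mean of $Y(1)$ and the limiting misspecified outcome regression for $Y(1)$, as described in the context. If $$\left|E\left[\left(\frac{e(X)}{e^*(X)}-1\right)\left(\mu_1(X)-\mu^*_1(X)\right)\right]\right|<\left|E\left[\left(\frac{e(X)}{e^*(X)}-1\right)\mu_1(X)\right]\right|,$$ then $$\left|E\left[\left(\frac{e(X)}{e^*(X)}-1\right)\mu^*_1(X)\right]\right|<2\cdot\left|E\left[\left(\frac{e(X)}{e^*(X)}-1\right)\mu_1(X)\right]\right|.$$
   Context: $X$ is a random vector of covariates, $T\in\{0,1\}$ a binary treatment, $Y(1)$ an integrable real-valued potential outcome with $Y(1)$ conditionally independent of $T$ given $X$. $e(X)=P(T=1\mid X)$, with $\eta<e(X)<1-\eta$ a.s. for some $\eta>0$; $e^*(X)$ is a measurable function of $X$ (the probability limit of a possibly misspecified propensity score model) with $\nu<e^*(X)<1-\nu$ a.s. for some $\nu>0$. $\mu_1(X)=E(Y(1)\mid X)$; $\mu^*_1(X)$ is an integrable function of $X$ (the probability limit of a possibly misspecified outcome regression model). The quantity $E[(\frac{e(X)}{e^*(X)}-1)(\mu_1(X)-\mu_1^*(X))]$ is the part of the asymptotic bias of the doubly robust estimator concerning $\mu_1=E[Y(1)]$, and $E[(\frac{e(X)}{e^*(X)}-1)\mu_1(X)]=E[\frac{e(X)}{e^*(X)}\mu_1(X)]-\mu_1$ is the corresponding part for the simple inverse probability weighting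 estimator. *)

theory Defs
  imports "HOL-Probability.Probability"
begin

text \<open>The sub-\<open>\<sigma>\<close>-algebra of events of \<open>M\<close> determined by \<open>X\<close>. The measure carried by
  \<open>sigma_gen M N X\<close> is irrelevant: \<open>real_cond_exp\<close> only uses its space and its sets, and
  takes the probabilities from \<open>M\<close>.\<close>

definition sigma_gen :: "'a measure \<Rightarrow> 'b measure \<Rightarrow> ('a \<Rightarrow> 'b) \<Rightarrow> 'a measure" where
  "sigma_gen M N X = vimage_algebra (space M) X N"

text \<open>\<open>m\<close> is a regression function of \<open>Z\<close> on \<open>X\<close>: a measurable \<open>m\<close> for which \<open>m(X)\<close> is a
  version of \<open>E(Z | X)\<close>.\<close>

definition cond_mean_given ::
  "'a measure \<Rightarrow> 'b measure \<Rightarrow> ('a \<Rightarrow> 'b) \<Rightarrow> ('a \<Rightarrow> real) \<Rightarrow> ('b \<Rightarrow> real) \<Rightarrow> bool" where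
  "cond_mean_given M N X Z m \<longleftrightarrow>
     m \<in> borel_measurable N \<and>
     (AE \<omega> in M. m (X \<omega>) = real_cond_exp M (sigma_gen M N X) Z \<omega>)"

definition cond_prob_given ::
  "'a measure \<Rightarrow> 'b measure \<Rightarrow> ('a \<Rightarrow> 'b) \<Rightarrow> 'a set \<Rightarrow> ('b \<Rightarrow> real) \<Rightarrow> bool" where
  "cond_prob_given M N X A p \<longleftrightarrow> cond_mean_given M N X (indicator A) p"

definition cond_indep_given ::
  "'a measure \<Rightarrow> 'b measure \<Rightarrow> ('a \<Rightarrow> 'b) \<Rightarrow> 'c measure \<Rightarrow> ('a \<Rightarrow> 'c) \<Rightarrow> 'd measure \<Rightarrow> ('a \<Rightarrow> 'd) \<Rightarrow> bool"
  where
  "cond_indep_given M N X K U L V \<longleftrightarrow>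
     (\<forall>A\<in>sets K. \<forall>B\<in>sets L. AE \<omega> in M.
        real_cond_exp M (sigma_gen M N X) (indicator {\<omega>\<in>space M. U \<omega> \<in> A \<and> V \<omega> \<in> B}) \<omega> =
        real_cond_exp M (sigma_gen M N X) (indicator {\<omega>\<in>space M. U \<omega> \<in> A}) \<omega> *
        real_cond_exp M (sigma_gen M N X) (indicator {\<omega>\<in>space M. V \<omega> \<in> B}) \<omega>)"

end

theory Submission
  imports Defs
begin

text \<open>Put w = e(X)/e*(X) - 1, a = E[w mu1(X)] and b = E[w mu1*(X)]. By linearity the assumed
  inequality reads |a - b| < |a|, so the triangle inequality gives |b| \<le> |a| + |a - b| < 2|a|.
  The analytic content is that linearity applies, i.e. that both products are integrable: w is
  essentially bounded because e* stays above \<nu>, mu1*(X) is integrable by assumption, and mu1(X)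
  is integrable by \<open>cond_mean_given_integrable\<close>.\<close>

lemma cond_mean_given_integrable:
  fixes Z :: "'a \<Rightarrow> real"
  assumes "prob_space M" and X: "X \<in> measurable M N" and "integrable M Z"
    and m: "cond_mean_given M N X Z m"
  shows "integrable M (\<lambda>\<omega>. m (X \<omega>))"
proof -
  interpret prob_space M by fact
  have "subalgebra M (sigma_gen M N X)"
    unfolding subalgebra_def sigma_gen_def
    using X by (auto simp: sets_vimage_algebra2 measurable_space measurable_sets)
  \<comment> \<open>A finite measure is \<sigma>-finite on every sub-\<sigma>-algebra; in this
    setting conditional expectation preserves integrability, which then passes to m(X) along almost
    sure equality.\<close>
  then interpret S: finite_measure_subalgebra M "sigma_gen M N X"
    by unfold_locales
  have [measurable]: "m \<in> borel_measurable N"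
    and eq: "AE \<omega> in M. m (X \<omega>) = real_cond_exp M (sigma_gen M N X) Z \<omega>"
    using m unfolding cond_mean_given_def by auto
  have "(\<lambda>\<omega>. m (X \<omega>)) \<in> borel_measurable M"
    using X by measurable
  moreover have "integrable M (real_cond_exp M (sigma_gen M N X) Z)"
    by (rule S.real_cond_exp_int) fact
  ultimately show ?thesis
    using eq by (subst integrable_cong_AE[OF _ _ eq]) auto
qed

theorem theorem11:
  fixes M :: "'a measure"
    and X :: "'a \<Rightarrow> real ^ 'p"
    and T :: "'a \<Rightarrow> nat"
    and Y1 :: "'a \<Rightarrow> real"
    and e e_star mu1 mu1_star :: "real ^ 'p \<Rightarrow> real"
    and \<eta> \<nu> :: real
  assumes "prob_space M"
    and "X \<in> borel_measurable M"
    and "T \<in> measurable M (count_space {0, 1})"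
    and "integrable M Y1"
    and "cond_indep_given M borel X borel Y1 (count_space {0, 1}) T"
    and "cond_prob_given M borel X {\<omega>\<in>space M. T \<omega> = 1} e"
    and "\<eta> > 0"
    and "AE \<omega> in M. \<eta> < e (X \<omega>) \<and> e (X \<omega>) < 1 - \<eta>"
    and "e_star \<in> borel_measurable borel"
    and "\<nu> > 0"
    and "AE \<omega> in M. \<nu> < e_star (X \<omega>) \<and> e_star (X \<omega>) < 1 - \<nu>"
    and "cond_mean_given M borel X Y1 mu1"
    and "mu1_star \<in> borel_measurable borel"
    and "integrable M (\<lambda>\<omega>. mu1_star (X \<omega>))"
    and "\<bar>\<integral>\<omega>. (e (X \<omega>) / e_star (X \<omega>) - 1) * (mu1 (X \<omega>) - mu1_star (X \<omega>)) \<partial>M\<bar>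
         < \<bar>\<integral>\<omega>. (e (X \<omega>) / e_star (X \<omega>) - 1) * mu1 (X \<omega>) \<partial>M\<bar>"
  shows "\<bar>\<integral>\<omega>. (e (X \<omega>) / e_star (X \<omega>) - 1) * mu1_star (X \<omega>) \<partial>M\<bar>
         < 2 * \<bar>\<integral>\<omega>. (e (X \<omega>) / e_star (X \<omega>) - 1) * mu1 (X \<omega>) \<partial>M\<bar>"
proof -
  interpret prob_space M by fact
  note [measurable] = assms(2,9,13)
  have [measurable]: "e \<in> borel_measurable borel" "mu1 \<in> borel_measurable borel"
    using assms(6,12) unfolding cond_prob_given_def cond_mean_given_def by auto
  define w where "w \<omega> = e (X \<omega>) / e_star (X \<omega>) - 1" for \<omega>
  have [measurable]: "w \<in> borel_measurable M"
    unfolding w_def by measurable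
  \<comment> \<open>Almost surely 0 < e(X) < 1 and e*(X) > \<nu>, so the ratio lies in [0, 1/\<nu>]
    and \<open>w\<close> in [-1, 1/\<nu>]; the constant covers both ends.\<close>
  have bound: "AE \<omega> in M. \<bar>w \<omega>\<bar> \<le> 1 / \<nu> + 1"
    using assms(8,11)
  proof eventually_elim
    case (elim \<omega>)
    have "e (X \<omega>) / e_star (X \<omega>) \<le> 1 / \<nu>" "0 \<le> e (X \<omega>) / e_star (X \<omega>)"
      using elim \<open>\<eta> > 0\<close> \<open>\<nu> > 0\<close> by (auto intro!: frac_le)
    then show ?case
      using \<open>\<nu> > 0\<close> unfolding w_def by auto
  qed
  \<comment> \<open>Domination by a constant multiple of \<open>f\<close>, stated for general
    \<open>f\<close> to serve both the true and the limiting outcome regression.\<close>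
  have weighted: "integrable M (\<lambda>\<omega>. w \<omega> * f \<omega>)" if "integrable M f" for f :: "'a \<Rightarrow> real"
  proof (rule Bochner_Integration.integrable_bound)
    show "integrable M (\<lambda>\<omega>. (1 / \<nu> + 1) * f \<omega>)"
      using that by simp
    show "(\<lambda>\<omega>. w \<omega> * f \<omega>) \<in> borel_measurable M"
      using that by measurable
    show "AE \<omega> in M. norm (w \<omega> * f \<omega>) \<le> norm ((1 / \<nu> + 1) * f \<omega>)"
      using bound
    proof eventually_elim
      case (elim \<omega>)
      then have "\<bar>w \<omega>\<bar> \<le> \<bar>1 / \<nu> + 1\<bar>" by linarith
      then show ?case
        by (simp only: real_norm_def abs_mult mult_right_mono abs_ge_zero)
    qed
  qed
  have "integrable M (\<lambda>\<omega>. mu1 (X \<omega>))"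
    using assms(1,2,4,12) by (rule cond_mean_given_integrable)
  \<comment> \<open>The Bochner integral is 0 by default on non-integrable functions, so the split
    rests on integrability of both products.\<close>
  then have "(\<integral>\<omega>. w \<omega> * (mu1 (X \<omega>) - mu1_star (X \<omega>)) \<partial>M)
      = (\<integral>\<omega>. w \<omega> * mu1 (X \<omega>) \<partial>M) - (\<integral>\<omega>. w \<omega> * mu1_star (X \<omega>) \<partial>M)"
    using weighted assms(14) by (simp add: right_diff_distrib)
  \<comment> \<open>What remains is the triangle inequality, linear arithmetic in the integrals a
    and b.\<close>
  then show ?thesis
    using assms(15) unfolding w_def by linarith
qed

end
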